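(* Suppose $d\geq 2$ and $f:[0,4]\to[-\infty,\infty)$ is a function continuous on $(0,4]$, differentiable in $(0,4)$ with a convex derivative $f'$ on $(0,4)$, such that $\lim_{t\to 0^+}f(t)=f(0)$. Let $\omega_d^\ast$ be the set of vertices of a regular $d$-simplex inscribed in $S^{d-1}$. Then the absolute maximum of the potential $p_f(\mathbf x,\omega_d^\ast)$ over $\mathbf x\in S^{d-1}$ is achieved at every point of the set $-\omega_d^\ast$. Furthermore, $$\max_{\mathbf x\in S^{d-1}}p_f(\mathbf x,\omega_d^\ast)=f(4)+d\cdot f\left(2-\frac{2}{d}\right).\qquad(1)$$ If, in addition, $f(0)>-\infty$, then the absolute minimum of the potential $p_f(\mathbf x,\omega_d^\ast)$ over $\mathbf x\in S^{d-1}$ is achieved at every point of $\omega_d^\ast$, with $$P_f(\omega_d^\ast,S^{d-1})=\min_{\mathbf x\in S^{d-1}}p_f(\mathbf x,\omega_d^\ast)=f(0)+d\cdot f\left(2+\frac{2}{d}\right).\qquad(2)$$ If the convexity of $f'$ is strict on $(0,4)$, then the maximum in (1) is attained only at the points of $-\omega_d^\ast$ and the minimum in (2) is attained only at the points of $\omega_d^\ast$.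
   Context: $S^{d-1}=\{\mathbf x\in\mathbb R^d: |\mathbf x|=1\}$, where $|\cdot|$ is the Euclidean norm. The vertices $\omega_d^\ast=\{\mathbf x_0,\ldots,\mathbf x_d\}$ of a regular $d$-simplex inscribed in $S^{d-1}$ are $d+1$ points of $S^{d-1}$ whose pairwise distances are all equal (equivalently, distinct vertices have inner product $-1/d$); $-\omega_d^\ast=\{-\mathbf x_0,\ldots,-\mathbf x_d\}$ is the set of antipodes. The potential is $$p_f(\mathbf x,\omega_d^\ast)=\sum_{i=0}^{d} f(|\mathbf x-\mathbf x_i|^2),\ \ \mathbf x\in S^{d-1},$$ and $P_f(\omega_d^\ast,S^{d-1})=\min_{\mathbf x\in S^{d-1}}p_f(\mathbf x,\omega_d^\ast)$. The function $f$ is finite on $(0,4]$; only $f(0)$ may be $-\infty$, and the limit at $0$ is understood in the extended sense. *)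

theory Defs
  imports "HOL-Analysis.Analysis"
begin

definition strictly_convex_on :: "real set \<Rightarrow> (real \<Rightarrow> real) \<Rightarrow> bool"
  where "strictly_convex_on S g \<longleftrightarrow> convex S \<and>
    (\<forall>x\<in>S. \<forall>y\<in>S. \<forall>u>0. \<forall>v>0. x \<noteq> y \<longrightarrow> u + v = 1 \<longrightarrow>
      g (u * x + v * y) < u * g x + v * g y)"

definition regular_simplex_vertices :: "(real ^ 'd) set \<Rightarrow> bool"
  where "regular_simplex_vertices W \<longleftrightarrow>
    W \<subseteq> sphere 0 1 \<and> card W = CARD('d) + 1 \<and>
    (\<exists>c. \<forall>x\<in>W. \<forall>y\<in>W. x \<noteq> y \<longrightarrow> dist x y = c)"

text \<open>For \<open>x\<close> and \<open>W\<close> on the unit sphere the squared distances lie in \<open>{0..4}\<close>, so only the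
  values of \<open>f\<close> on that interval matter. If these are all below \<open>\<infinity>\<close>, the sum never
  involves the conventional value \<open>\<infinity> + -\<infinity> = \<infinity>\<close> of \<^typ>\<open>ereal\<close>.\<close>

definition potential :: "(real \<Rightarrow> ereal) \<Rightarrow> (real ^ 'd) set \<Rightarrow> real ^ 'd \<Rightarrow> ereal"
  where "potential f W x = (\<Sum>y\<in>W. f ((norm (x - y))\<^sup>2))"

text \<open>An infimum in \<^typ>\<open>ereal\<close>; it is a minimum as soon as some point satisfies
  \<^const>\<open>is_arg_min\<close>.\<close>

definition min_potential :: "(real \<Rightarrow> ereal) \<Rightarrow> (real ^ 'd) set \<Rightarrow> ereal"
  where "min_potential f W = (INF x\<in>sphere 0 1. potential f W x)"

text \<open>Likewise a maximum as soon as some point satisfies \<^const>\<open>is_arg_max\<close>.\<close>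

definition max_potential :: "(real \<Rightarrow> ereal) \<Rightarrow> (real ^ 'd) set \<Rightarrow> ereal"
  where "max_potential f W = (SUP x\<in>sphere 0 1. potential f W x)"

end

theory Submission
  imports Defs
begin

text \<open>
  Write \<open>n\<close> for the dimension. A regular simplex \<open>W\<close> is a spherical design of strength two: its
  centroid is the origin, and the vectors of \<open>W\<close> form a tight frame. Hence the potential
  of every polynomial of degree at most two is constant on the sphere
  (\<open>quadratic_potential_constant\<close>), and it suffices to bound \<open>f\<close> by a suitable parabola.

  Seen from an antipode \<open>-w\<close>, the squared distances to \<open>W\<close> are \<open>4\<close>, once, and \<open>2 - 2/n\<close>,
  \<open>n\<close> times. Let \<open>h\<close> be the parabola that agrees with \<open>f\<close> at \<open>4\<close> and is tangent to \<open>f\<close> at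
  \<open>2 - 2/n\<close>. If \<open>f\<close> had a third derivative, the Hermite error formula would express \<open>f - h\<close> as
  a nonnegative multiple of \<open>(t - (2 - 2/n))\<^sup>2 (t - 4)\<close>, so that \<open>f \<le> h\<close>; convexity of \<open>f'\<close>
  yields the same bound (\<open>hermite_parabola_majorant\<close>). The potential of \<open>f\<close> is then at most the
  constant potential of \<open>h\<close>, with equality at \<open>-w\<close>, where \<open>f\<close> is sampled only at contact points.

  When \<open>f'\<close> is strictly convex there are no further contact points, so at any maximiser all
  squared distances are \<open>4\<close> or \<open>2 - 2/n\<close>. They cannot all be the latter, because their mean is
  \<open>2\<close>; and a distance of \<open>2\<close> from a vertex means being its antipode.

  The minimum is the same statement for \<open>t \<mapsto> -f (4 - t)\<close>, whose derivative is again convex,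
  because \<open>\<bar>x - y\<bar>\<^sup>2 + \<bar>-x - y\<bar>\<^sup>2 = 4\<close> on the sphere. Finiteness of \<open>f 0\<close> is what makes the reflected
  function finite and continuous at the endpoint \<open>4\<close>, where it is interpolated.
\<close>

section \<open>The regular simplex as a spherical design\<close>

text \<open>
  The coefficients of a linear relation form a kernel vector of the Gram matrix. That matrix
  is \<open>1 - a\<close> times the identity plus a multiple of the all-ones matrix, so only constant vectors
  can lie in its kernel. This yields both the centroid of a regular simplex and the independence
  of any proper subset of its vertices.
\<close>

lemma equiangular_relation_constant:
  fixes W :: "'a::real_inner set"
  assumes fin: "finite W" and "a \<noteq> 1"
    and gram: "\<And>v w. v \<in> W \<Longrightarrow> w \<in> W \<Longrightarrow> v \<bullet> w = (if v = w then 1 else a)"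
    and rel: "(\<Sum>w\<in>W. u w *\<^sub>R w) = 0"
    and vw: "v \<in> W" "w \<in> W"
  shows "u v = u w"
proof -
  have "(1 - a) * u v = - a * sum u W" if v: "v \<in> W" for v
  proof -
    have "0 = v \<bullet> (\<Sum>w\<in>W. u w *\<^sub>R w)"
      using rel by simp
    also have "\<dots> = (\<Sum>w\<in>W. u w * (v \<bullet> w))"
      by (simp add: inner_sum_right)
    also have "\<dots> = (\<Sum>w\<in>W. a * u w + (if w = v then (1 - a) * u v else 0))"
      by (rule sum.cong) (auto simp: gram v algebra_simps)
    also have "\<dots> = a * sum u W + (1 - a) * u v"
      using fin v by (simp add: sum.distrib sum_distrib_left)
    finally show ?thesis by simp
  qed
  then have "(1 - a) * u v = (1 - a) * u w"
    using vw by metis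
  then show ?thesis
    using \<open>a \<noteq> 1\<close> by simp
qed

lemma regular_simplex_finite:
  "regular_simplex_vertices W \<Longrightarrow> finite W"
  unfolding regular_simplex_vertices_def by (metis Suc_eq_plus1 card.infinite nat.distinct(1))

lemma regular_simplex_unit:
  assumes "regular_simplex_vertices W" "w \<in> W"
  shows "norm w = 1"
  using assms unfolding regular_simplex_vertices_def by auto

lemma norm_diff_power2_unit:
  fixes x y :: "'a::real_inner"
  assumes "norm x = 1" "norm y = 1"
  shows "(norm (x - y))\<^sup>2 = 2 - 2 * (x \<bullet> y)"
  using assms by (simp add: power2_norm_eq_inner norm_eq_1 inner_diff inner_commute)

lemma antipode_if_norm_diff_power2_eq_4:
  fixes x y :: "'a::real_inner"
  assumes "norm x = 1" "norm y = 1" "(norm (x - y))\<^sup>2 = 4"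
  shows "x = - y"
proof -
  have "(norm (x + y))\<^sup>2 = 0"
    using assms norm_diff_power2_unit[OF assms(1,2)] norm_diff_power2_unit[of x "- y"] by simp
  then show ?thesis
    by (simp add: eq_neg_iff_add_eq_0)
qed

text \<open>
  There are more than \<open>n\<close> vertices, so they satisfy some nontrivial linear relation; its
  coefficients are all equal, hence the vertices add up to zero. Pairing this with one vertex
  determines the common inner product.
\<close>

lemma regular_simplex_sum_and_inner:
  fixes W :: "(real ^ 'd) set"
  assumes W: "regular_simplex_vertices W"
  shows "\<Sum>W = 0"
    and "v \<in> W \<Longrightarrow> w \<in> W \<Longrightarrow> v \<bullet> w = (if v = w then 1 else - 1 / real CARD('d))"
proof -
  let ?n = "real CARD('d)"
  have fin: "finite W" and card: "card W = CARD('d) + 1"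
    using W regular_simplex_finite unfolding regular_simplex_vertices_def by auto
  have self: "w \<bullet> w = 1" if "w \<in> W" for w
    using regular_simplex_unit[OF W that] by (simp add: norm_eq_1)
  have "\<exists>c. \<forall>v\<in>W. \<forall>w\<in>W. v \<noteq> w \<longrightarrow> dist v w = c"
    using W by (simp add: regular_simplex_vertices_def)
  then obtain c where c: "\<And>v w. v \<in> W \<Longrightarrow> w \<in> W \<Longrightarrow> v \<noteq> w \<Longrightarrow> dist v w = c"
    by auto
  define a where "a = 1 - c\<^sup>2 / 2"
  have gram: "v \<bullet> w = (if v = w then 1 else a)" if "v \<in> W" "w \<in> W" for v w
  proof (cases "v = w")
    case False
    then have "c\<^sup>2 = 2 - 2 * (v \<bullet> w)"
      using norm_diff_power2_unit[of v w] regular_simplex_unit[OF W] c that by (simp add: dist_norm)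
    then show ?thesis
      using False by (simp add: a_def field_simps)
  qed (simp add: self that)
  obtain v0 w0 where v0w0: "v0 \<in> W" "w0 \<in> W" "v0 \<noteq> w0"
  proof -
    have "\<not> card W \<le> 1"
      using card by simp
    then show ?thesis
      using that fin card_le_Suc0_iff_eq[of W] by auto
  qed
  then have "c > 0"
    using c by (metis dist_nz)
  then have "a \<noteq> 1"
    by (simp add: a_def)
  have "dependent W"
    by (rule dependent_biggerset) (simp add: card)
  then obtain u where u: "(\<Sum>w\<in>W. u w *\<^sub>R w) = 0" and "\<exists>w\<in>W. u w \<noteq> 0"
    using fin by (auto simp: dependent_finite)
  then obtain w1 where w1: "w1 \<in> W" "u w1 \<noteq> 0"
    by blast
  have "(\<Sum>w\<in>W. u w *\<^sub>R w) = (\<Sum>w\<in>W. u w1 *\<^sub>R w)"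
    using equiangular_relation_constant[OF fin \<open>a \<noteq> 1\<close> gram u _ w1(1)] by (intro sum.cong) auto
  then have "u w1 *\<^sub>R \<Sum>W = 0"
    using u by (simp add: scaleR_sum_right)
  then show sum0: "\<Sum>W = 0"
    using w1 by simp
  have "0 = w1 \<bullet> \<Sum>W"
    using sum0 by simp
  also have "\<dots> = w1 \<bullet> w1 + (\<Sum>w\<in>W - {w1}. w1 \<bullet> w)"
    unfolding inner_sum_right by (rule sum.remove[OF fin w1(1)])
  also have "(\<Sum>w\<in>W - {w1}. w1 \<bullet> w) = (\<Sum>w\<in>W - {w1}. a)"
    by (rule sum.cong) (auto simp: gram w1)
  also have "\<dots> = ?n * a"
    using card w1 fin by simp
  finally have "a = - 1 / ?n"
    using self[OF w1(1)] by (simp add: field_simps)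
  then show "v \<in> W \<Longrightarrow> w \<in> W \<Longrightarrow> v \<bullet> w = (if v = w then 1 else - 1 / ?n)"
    using gram by simp
qed

text \<open>
  Dropping one vertex leaves a basis, since a relation among the others would be a relation on \<open>W\<close>
  with one vanishing coefficient.
\<close>

lemma regular_simplex_spans:
  fixes W :: "(real ^ 'd) set"
  assumes W: "regular_simplex_vertices W"
  shows "span W = UNIV"
proof -
  let ?n = "real CARD('d)"
  have fin: "finite W" and card: "card W = CARD('d) + 1"
    using W regular_simplex_finite unfolding regular_simplex_vertices_def by auto
  then obtain w where w: "w \<in> W"
    by fastforce
  have "independent (W - {w})"
  proof (rule notI)
    assume "dependent (W - {w})"
    then obtain u v where rel: "(\<Sum>y\<in>W - {w}. u y *\<^sub>R y) = 0"
      and v: "v \<in> W" "v \<noteq> w" "u v \<noteq> 0"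
      using fin by (auto simp: dependent_finite)
    define u' where "u' y = (if y = w then 0 else u y)" for y
    have "(\<Sum>y\<in>W. u' y *\<^sub>R y) = (\<Sum>y\<in>W - {w}. u' y *\<^sub>R y)"
      using sum.remove[OF fin w, of "\<lambda>y. u' y *\<^sub>R y"] by (simp add: u'_def)
    also have "\<dots> = 0"
      unfolding rel[symmetric] by (rule sum.cong) (auto simp: u'_def)
    finally have rel': "(\<Sum>y\<in>W. u' y *\<^sub>R y) = 0" .
    have "- 1 / ?n \<noteq> 1"
      by (simp add: field_simps)
    from equiangular_relation_constant[OF fin this regular_simplex_sum_and_inner(2)[OF W] rel'
        v(1) w]
    show False
      using v by (simp add: u'_def)
  qed
  then have "UNIV \<subseteq> span (W - {w})"
    by (rule card_ge_dim_independent[OF subset_UNIV]) (simp add: card w fin)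
  then show ?thesis
    using span_mono[of "W - {w}" W] by blast
qed

text \<open>
  The frame operator has each vertex as an eigenvector, with the same eigenvalue, and the
  vertices span.
\<close>

lemma regular_simplex_tight_frame:
  fixes W :: "(real ^ 'd) set" and x :: "real ^ 'd"
  assumes W: "regular_simplex_vertices W"
  shows "(\<Sum>y\<in>W. (x \<bullet> y)\<^sup>2) = (1 + 1 / real CARD('d)) * (norm x)\<^sup>2"
proof -
  let ?n = "real CARD('d)"
  have fin: "finite W"
    by (rule regular_simplex_finite[OF W])
  define T where "T x = (\<Sum>y\<in>W. (x \<bullet> y) *\<^sub>R y)" for x
  have "T x = (1 + 1 / ?n) *\<^sub>R x"
  proof (rule linear_eq_on_span[of T "\<lambda>x. (1 + 1 / ?n) *\<^sub>R x" W x])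
    show "linear T"
      unfolding T_def
      by (intro linearI) (simp_all add: inner_add_left scaleR_add_left sum.distrib scaleR_sum_right)
    show "linear (\<lambda>x::real^'d. (1 + 1 / ?n) *\<^sub>R x)"
      by (rule linear_scaleR)
    show "x \<in> span W"
      by (simp add: regular_simplex_spans[OF W])
    fix w assume w: "w \<in> W"
    have "T w = (\<Sum>y\<in>W. (- 1 / ?n) *\<^sub>R y + (if y = w then (1 + 1 / ?n) *\<^sub>R w else 0))"
      unfolding T_def
      by (rule sum.cong)
        (auto simp: regular_simplex_sum_and_inner(2)[OF W w] algebra_simps)
    also have "\<dots> = (- 1 / ?n) *\<^sub>R \<Sum>W + (1 + 1 / ?n) *\<^sub>R w"
      using fin w by (simp only: sum.distrib scaleR_sum_right sum.delta if_True)
    finally show "T w = (1 + 1 / ?n) *\<^sub>R w"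
      by (simp only: regular_simplex_sum_and_inner(1)[OF W] scaleR_zero_right add_0_left)
  qed
  then have "x \<bullet> T x = (1 + 1 / ?n) * (norm x)\<^sup>2"
    by (simp add: power2_norm_eq_inner)
  moreover have "x \<bullet> T x = (\<Sum>y\<in>W. (x \<bullet> y)\<^sup>2)"
    by (simp add: T_def inner_sum_right power2_eq_square)
  ultimately show ?thesis by simp
qed

lemma regular_simplex_sum_dist_power2:
  fixes W :: "(real ^ 'd) set" and x :: "real ^ 'd"
  assumes W: "regular_simplex_vertices W" and x: "norm x = 1"
  shows "(\<Sum>y\<in>W. (norm (x - y))\<^sup>2) = 2 * (real CARD('d) + 1)"
proof -
  have "(\<Sum>y\<in>W. (norm (x - y))\<^sup>2) = (\<Sum>y\<in>W. 2 - 2 * (x \<bullet> y))"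
    by (rule sum.cong) (auto simp: norm_diff_power2_unit x regular_simplex_unit[OF W])
  also have "\<dots> = 2 * real (card W) - 2 * (x \<bullet> \<Sum>W)"
    by (simp add: sum_subtractf inner_sum_right sum_distrib_left)
  finally show ?thesis
    using W by (simp add: regular_simplex_sum_and_inner(1) regular_simplex_vertices_def)
qed

text \<open>
  In terms of \<open>x \<bullet> y\<close> the linear part of the sum vanishes because the centroid is zero, and
  the quadratic part depends only on \<open>norm x\<close> by the tight frame identity. The polynomial is
  expanded at \<open>s\<close> because it will be given by its tangent there.
\<close>

lemma quadratic_potential_constant:
  fixes W :: "(real ^ 'd) set" and x z :: "real ^ 'd"
  assumes W: "regular_simplex_vertices W" and xz: "norm x = 1" "norm z = 1"
  shows "(\<Sum>y\<in>W. A + B * ((norm (x - y))\<^sup>2 - s) + C * ((norm (x - y))\<^sup>2 - s)\<^sup>2) =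
    (\<Sum>y\<in>W. A + B * ((norm (z - y))\<^sup>2 - s) + C * ((norm (z - y))\<^sup>2 - s)\<^sup>2)"
proof -
  have "(\<Sum>y\<in>W. A + B * ((norm (x - y))\<^sup>2 - s) + C * ((norm (x - y))\<^sup>2 - s)\<^sup>2) =
      real (card W) * (A + B * (2 - s) + C * (2 - s)\<^sup>2) + 4 * C * (1 + 1 / real CARD('d))"
    if x: "norm x = 1" for x :: "real ^ 'd"
  proof -
    have "(\<Sum>y\<in>W. A + B * ((norm (x - y))\<^sup>2 - s) + C * ((norm (x - y))\<^sup>2 - s)\<^sup>2) =
      (\<Sum>y\<in>W. (A + B * (2 - s) + C * (2 - s)\<^sup>2) + (- 2 * B - 4 * C * (2 - s)) * (x \<bullet> y)
         + 4 * C * (x \<bullet> y)\<^sup>2)"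
    proof (rule sum.cong[OF refl])
      fix y assume "y \<in> W"
      then have dist: "(norm (x - y))\<^sup>2 = 2 - 2 * (x \<bullet> y)"
        by (simp add: norm_diff_power2_unit x regular_simplex_unit[OF W])
      show "A + B * ((norm (x - y))\<^sup>2 - s) + C * ((norm (x - y))\<^sup>2 - s)\<^sup>2 =
          (A + B * (2 - s) + C * (2 - s)\<^sup>2) + (- 2 * B - 4 * C * (2 - s)) * (x \<bullet> y)
            + 4 * C * (x \<bullet> y)\<^sup>2"
        unfolding dist by (simp add: power2_eq_square algebra_simps)
    qed
    also have "\<dots> = real (card W) * (A + B * (2 - s) + C * (2 - s)\<^sup>2)
        + (- 2 * B - 4 * C * (2 - s)) * (x \<bullet> \<Sum>W) + 4 * C * (\<Sum>y\<in>W. (x \<bullet> y)\<^sup>2)"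
      unfolding sum.distrib sum_distrib_left[symmetric] inner_sum_right by (simp add: distrib_left)
    finally show ?thesis
      by (simp add: regular_simplex_sum_and_inner(1)[OF W] regular_simplex_tight_frame[OF W] x)
  qed
  then show ?thesis
    using xz by simp
qed

lemma sum_dist_power2_at_vertex:
  fixes W :: "(real ^ 'd) set" and F :: "real \<Rightarrow> real"
  assumes W: "regular_simplex_vertices W" and w: "w \<in> W"
  shows "(\<Sum>y\<in>W. F ((norm (w - y))\<^sup>2)) = F 0 + real CARD('d) * F (2 + 2 / real CARD('d))"
proof -
  have fin: "finite W" and card: "card W = CARD('d) + 1"
    using W regular_simplex_finite unfolding regular_simplex_vertices_def by auto
  have "(\<Sum>y\<in>W. F ((norm (w - y))\<^sup>2)) = F 0 + (\<Sum>y\<in>W - {w}. F ((norm (w - y))\<^sup>2))"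
    using sum.remove[OF fin w, of "\<lambda>y. F ((norm (w - y))\<^sup>2)"] by simp
  also have "(\<Sum>y\<in>W - {w}. F ((norm (w - y))\<^sup>2)) = (\<Sum>y\<in>W - {w}. F (2 + 2 / real CARD('d)))"
    by (rule sum.cong)
      (auto simp: norm_diff_power2_unit regular_simplex_unit[OF W] w
        regular_simplex_sum_and_inner(2)[OF W])
  finally show ?thesis
    using card w fin by simp
qed

lemma norm_minus_diff_power2_unit:
  fixes x y :: "'a::real_inner"
  assumes "norm x = 1" "norm y = 1"
  shows "(norm (- x - y))\<^sup>2 = 4 - (norm (x - y))\<^sup>2"
  using norm_diff_power2_unit[of x y] norm_diff_power2_unit[of "- x" y] assms by simp

lemma norm_diff_power2_unit_range:
  fixes x y :: "'a::real_inner"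
  assumes "norm x = 1" "norm y = 1"
  shows "(norm (x - y))\<^sup>2 \<in> {0..4}"
  using norm_minus_diff_power2_unit[OF assms] zero_le_power2[of "norm (- x - y)"] by simp

lemma sum_dist_power2_at_antipode:
  fixes W :: "(real ^ 'd) set" and F :: "real \<Rightarrow> real"
  assumes W: "regular_simplex_vertices W" and w: "w \<in> W"
  shows "(\<Sum>y\<in>W. F ((norm (- w - y))\<^sup>2)) = F 4 + real CARD('d) * F (2 - 2 / real CARD('d))"
proof -
  have "(\<Sum>y\<in>W. F ((norm (- w - y))\<^sup>2)) = (\<Sum>y\<in>W. F (4 - (norm (w - y))\<^sup>2))"
    by (rule sum.cong) (auto simp: norm_minus_diff_power2_unit regular_simplex_unit[OF W] w)
  then show ?thesis
    using sum_dist_power2_at_vertex[OF W w, of "\<lambda>t. F (4 - t)"] by (simp add: algebra_simps)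
qed

section \<open>Parabolas above functions with convex derivative\<close>

lemma convex_on_three_points:
  fixes \<phi> :: "real \<Rightarrow> real"
  assumes conv: "convex_on S \<phi>" and "x \<in> S" "z \<in> S" and "x < y" "y < z"
  shows "(z - x) * \<phi> y \<le> (z - y) * \<phi> x + (y - x) * \<phi> z"
proof -
  define t where "t = (y - x) / (z - x)"
  have t: "0 \<le> t" "t \<le> 1" "(z - x) * t = y - x"
    using assms by (auto simp: t_def)
  then have "(1 - t) * x + t * z = y"
    by (simp add: algebra_simps)
  then have "\<phi> y \<le> (1 - t) * \<phi> x + t * \<phi> z"
    using convex_onD[OF conv t(1,2) \<open>x \<in> S\<close> \<open>z \<in> S\<close>] by simp
  then have "(z - x) * \<phi> y \<le> (z - x) * ((1 - t) * \<phi> x + t * \<phi> z)"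
    using assms by (intro mult_left_mono) auto
  also have "\<dots> = ((z - x) - (z - x) * t) * \<phi> x + ((z - x) * t) * \<phi> z"
    by (simp add: algebra_simps)
  finally show ?thesis
    by (simp add: t(3))
qed

lemma strictly_convex_on_not_collinear:
  assumes conv: "strictly_convex_on S \<phi>" and "x \<in> S" "z \<in> S" and "x < y" "y < z"
    and line: "\<phi> x = p + q * x" "\<phi> z = p + q * z"
  shows "\<phi> y \<noteq> p + q * y"
proof -
  define t where "t = (y - x) / (z - x)"
  have t: "0 < t" "t < 1" "(z - x) * t = y - x"
    using assms by (auto simp: t_def)
  then have y: "(1 - t) * x + t * z = y"
    by (simp add: algebra_simps)
  have "\<phi> ((1 - t) * x + t * z) < (1 - t) * \<phi> x + t * \<phi> z"
    using conv t assms(2-5) unfolding strictly_convex_on_def by auto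
  also have "\<dots> = p + q * ((1 - t) * x + t * z)"
    by (simp add: line algebra_simps)
  finally show ?thesis
    by (simp add: y)
qed

text \<open>
  Let \<open>g = F - h\<close>, where \<open>h\<close> is the parabola tangent to \<open>F\<close> at \<open>s\<close> and meeting it at \<open>b\<close>. Its
  derivative is convex and vanishes at \<open>s\<close> and, by Rolle, at some \<open>c\<close> between \<open>s\<close> and \<open>b\<close>. So
  \<open>g\<close> increases to \<open>g s = 0\<close>, decreases up to \<open>c\<close>, and increases again to \<open>g b = 0\<close>. A third zero
  of \<open>g\<close> would, again by Rolle, produce a third zero of \<open>g'\<close>, that is, three collinear points on
  the graph of \<open>F'\<close>. The left endpoint \<open>a\<close> may or may not belong to \<open>I\<close>, because \<open>F\<close> is allowed
  to be singular there.
\<close>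

lemma hermite_parabola_majorant:
  fixes F F' :: "real \<Rightarrow> real"
  assumes s: "a < s" "s < b"
    and I: "{a<..b} \<subseteq> I" "I \<subseteq> {a..b}"
    and cont: "continuous_on I F"
    and deriv: "\<And>t. a < t \<Longrightarrow> t < b \<Longrightarrow> (F has_real_derivative F' t) (at t)"
    and conv: "convex_on {a<..<b} F'"
  obtains B C where "F b = F s + B * (b - s) + C * (b - s)\<^sup>2"
    and "\<And>t. t \<in> I \<Longrightarrow> F t \<le> F s + B * (t - s) + C * (t - s)\<^sup>2"
    and "\<And>t. strictly_convex_on {a<..<b} F' \<Longrightarrow> t \<in> I \<Longrightarrow>
      F t = F s + B * (t - s) + C * (t - s)\<^sup>2 \<Longrightarrow> t = s \<or> t = b"
proof -
  define B where "B = F' s"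
  define C where "C = (F b - F s - B * (b - s)) / (b - s)\<^sup>2"
  define g where "g t = F t - (F s + B * (t - s) + C * (t - s)\<^sup>2)" for t
  define \<phi> where "\<phi> t = F' t - (B + 2 * C * (t - s))" for t
  have "C * (b - s)\<^sup>2 = F b - F s - B * (b - s)"
    using s by (simp add: C_def)
  then have g0: "g s = 0" "g b = 0" and meets: "F b = F s + B * (b - s) + C * (b - s)\<^sup>2"
    by (auto simp: g_def)
  have \<phi>s: "\<phi> s = 0"
    by (simp add: \<phi>_def B_def)
  have sub: "{p..q} \<subseteq> I" if "p \<in> I" "q \<in> I" for p q
  proof
    fix t assume "t \<in> {p..q}"
    moreover have "a \<le> p" "q \<le> b"
      using that I by auto
    ultimately have "t = p \<or> t \<in> {a<..b}"
      by auto
    then show "t \<in> I"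
      using that I by blast
  qed
  have inner: "a < r" "r < b" if "p \<in> I" "q \<in> I" "p < r" "r < q" for p q r
  proof -
    have "a \<le> p" "q \<le> b"
      using that I by auto
    then show "a < r" "r < b"
      using that by auto
  qed
  have gcont: "continuous_on {p..q} g" if "p \<in> I" "q \<in> I" for p q
    unfolding g_def using continuous_on_subset[OF cont sub[OF that]]
    by (intro continuous_intros)
  have gderiv: "(g has_real_derivative \<phi> t) (at t)" if "a < t" "t < b" for t
    unfolding g_def \<phi>_def
    by (rule derivative_eq_intros deriv[OF that] refl | simp)+
  have rolle: "\<exists>r. p < r \<and> r < q \<and> \<phi> r = 0" if "p \<in> I" "q \<in> I" "p < q" "g p = 0" "g q = 0" for p q
  proof -
    have "\<exists>r. p < r \<and> r < q \<and> (g has_real_derivative 0) (at r)"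
    proof (rule Rolle[OF that(3) _ gcont[OF that(1,2)]])
      show "g p = g q"
        using that by simp
      show "g differentiable (at r)" if "p < r" "r < q" for r
        using gderiv inner[OF \<open>p \<in> I\<close> \<open>q \<in> I\<close> that] real_differentiable_def by blast
    qed
    then show ?thesis
      using inner[OF that(1,2)] gderiv DERIV_unique by blast
  qed
  have sI: "s \<in> I" and bI: "b \<in> I"
    using s I by auto
  obtain c where c: "s < c" "c < b" "\<phi> c = 0"
    using rolle[OF sI bI s(2) g0] by blast
  have cI: "c \<in> I"
    using c s I by auto
  have three: "(z - x) * \<phi> y \<le> (z - y) * \<phi> x + (y - x) * \<phi> z"
    if "a < x" "x < y" "y < z" "z < b" for x y z
    using convex_on_three_points[OF conv, of x z y] that unfolding \<phi>_def by (simp add: algebra_simps)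
  have incr1: "0 \<le> \<phi> t" if "a < t" "t < s" for t
    using three[OF that c(1,2)] \<phi>s c by (simp add: zero_le_mult_iff)
  have decr: "\<phi> t \<le> 0" if "s < t" "t < c" for t
    using three[OF s(1) that c(2)] \<phi>s c by (simp add: mult_le_0_iff)
  have incr2: "0 \<le> \<phi> t" if "c < t" "t < b" for t
    using three[OF s(1) c(1) that] \<phi>s c by (simp add: zero_le_mult_iff)
  have "g t \<le> 0" if t: "t \<in> I" for t
  proof -
    have bounds: "a \<le> t" "t \<le> b"
      using t I by auto
    consider "t \<le> s" | "s \<le> t" "t \<le> c" | "c \<le> t" by linarith
    then show ?thesis
    proof cases
      case 1
      have "g t \<le> g s"
        using bounds s 1 by (intro DERIV_nonneg_imp_increasing_open[OF 1 _ gcont[OF t sI]])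
          (meson gderiv incr1 le_less_trans less_trans)
      then show ?thesis by (simp add: g0)
    next
      case 2
      have "g t \<le> g s"
        using bounds s c 2 by (intro DERIV_nonpos_imp_decreasing_open[OF 2(1) _ gcont[OF sI t]])
          (meson gderiv decr less_le_trans less_trans)
      then show ?thesis by (simp add: g0)
    next
      case 3
      have "g t \<le> g b"
        using bounds s c by (intro DERIV_nonneg_imp_increasing_open[OF bounds(2) _ gcont[OF t bI]])
          (meson 3 gderiv incr2 le_less_trans less_trans)
      then show ?thesis by (simp add: g0)
    qed
  qed
  then have majorant: "F t \<le> F s + B * (t - s) + C * (t - s)\<^sup>2" if "t \<in> I" for t
    using that unfolding g_def by force
  have contact: "t = s \<or> t = b"
    if strict: "strictly_convex_on {a<..<b} F'" and t: "t \<in> I"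
      and eq: "F t = F s + B * (t - s) + C * (t - s)\<^sup>2" for t
  proof (rule ccontr)
    assume ne: "\<not> (t = s \<or> t = b)"
    \<comment> \<open>the zeros of \<open>\<phi>\<close> are the points where the graph of \<open>F'\<close> meets the line \<open>B + 2 * C * (t - s)\<close>\<close>
    have no3: False if "a < x" "x < y" "y < z" "z < b" "\<phi> x = 0" "\<phi> y = 0" "\<phi> z = 0" for x y z
      using strictly_convex_on_not_collinear[OF strict, of x z y "B - 2 * C * s" "2 * C"] that
      unfolding \<phi>_def by (simp add: algebra_simps)
    have gt: "g t = 0"
      using eq by (simp add: g_def)
    have bounds: "a \<le> t" "t < b"
      using t I ne by (auto simp: subset_iff)
    show False
    proof (cases "t < s")
      case True
      obtain r where "t < r" "r < s" "\<phi> r = 0"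
        using rolle[OF t sI True gt g0(1)] by blast
      then show False
        using no3[of r s c] bounds c \<phi>s by linarith
    next
      case False
      then have "s < t" using ne by simp
      obtain r where r: "s < r" "r < t" "\<phi> r = 0"
        using rolle[OF sI t \<open>s < t\<close> g0(1) gt] by blast
      obtain q where "t < q" "q < b" "\<phi> q = 0"
        using rolle[OF t bI bounds(2) gt g0(2)] by blast
      then show False
        using no3[of s r q] r s \<phi>s by linarith
    qed
  qed
  show ?thesis
    using that[OF meets majorant contact] by blast
qed

section \<open>Extrema of the potential\<close>

text \<open>
  The set \<open>I\<close> is all of \<open>[0, 4]\<close>, or \<open>(0, 4]\<close> when \<open>f\<close> is singular at \<open>0\<close>; in the second case
  the bound concerns points other than the vertices.
\<close>

lemma simplex_potential_upper_bound:
  fixes F F' :: "real \<Rightarrow> real" and W :: "(real ^ 'd) set"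
  assumes dim: "CARD('d) \<ge> 2"
    and W: "regular_simplex_vertices W"
    and I: "{0<..4} \<subseteq> I" "I \<subseteq> {0..4}"
    and cont: "continuous_on I F"
    and deriv: "\<And>t. 0 < t \<Longrightarrow> t < 4 \<Longrightarrow> (F has_real_derivative F' t) (at t)"
    and conv: "convex_on {0<..<4} F'"
    and x: "norm x = 1" "\<And>y. y \<in> W \<Longrightarrow> (norm (x - y))\<^sup>2 \<in> I"
  shows "(\<Sum>y\<in>W. F ((norm (x - y))\<^sup>2)) \<le> F 4 + real CARD('d) * F (2 - 2 / real CARD('d))"
    and "strictly_convex_on {0<..<4} F' \<Longrightarrow>
      (\<Sum>y\<in>W. F ((norm (x - y))\<^sup>2)) = F 4 + real CARD('d) * F (2 - 2 / real CARD('d)) \<Longrightarrow>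
      x \<in> uminus ` W"
proof -
  let ?n = "real CARD('d)"
  define s where "s = 2 - 2 / ?n"
  have fin: "finite W" and card: "card W = CARD('d) + 1"
    using W regular_simplex_finite unfolding regular_simplex_vertices_def by auto
  then obtain w where w: "w \<in> W"
    by fastforce
  have n: "?n \<ge> 2"
    using dim by simp
  then have s: "0 < s" "s < 4"
    by (auto simp: s_def field_simps)
  obtain B C where meets: "F 4 = F s + B * (4 - s) + C * (4 - s)\<^sup>2"
    and le: "\<And>t. t \<in> I \<Longrightarrow> F t \<le> F s + B * (t - s) + C * (t - s)\<^sup>2"
    and contact: "\<And>t. strictly_convex_on {0<..<4} F' \<Longrightarrow> t \<in> I \<Longrightarrow>
      F t = F s + B * (t - s) + C * (t - s)\<^sup>2 \<Longrightarrow> t = s \<or> t = 4"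
    using hermite_parabola_majorant[OF s I cont deriv conv] by blast
  define h where "h t = F s + B * (t - s) + C * (t - s)\<^sup>2" for t
  have "(\<Sum>y\<in>W. h ((norm (x - y))\<^sup>2)) = (\<Sum>y\<in>W. h ((norm (- w - y))\<^sup>2))"
    unfolding h_def
    by (rule quadratic_potential_constant[OF W]) (simp_all add: x regular_simplex_unit[OF W w])
  also have "\<dots> = F 4 + ?n * F s"
    using sum_dist_power2_at_antipode[OF W w, of h] meets by (simp add: h_def s_def)
  finally have sum_h: "(\<Sum>y\<in>W. h ((norm (x - y))\<^sup>2)) = F 4 + ?n * F s" .
  have le_h: "F ((norm (x - y))\<^sup>2) \<le> h ((norm (x - y))\<^sup>2)" if "y \<in> W" for y
    using le[OF x(2)[OF that]] by (simp add: h_def)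
  show "(\<Sum>y\<in>W. F ((norm (x - y))\<^sup>2)) \<le> F 4 + ?n * F (2 - 2 / ?n)"
    using sum_mono[of W "\<lambda>y. F ((norm (x - y))\<^sup>2)" "\<lambda>y. h ((norm (x - y))\<^sup>2)", OF le_h]
    unfolding sum_h s_def by simp
  assume strict: "strictly_convex_on {0<..<4} F'"
    and "(\<Sum>y\<in>W. F ((norm (x - y))\<^sup>2)) = F 4 + ?n * F (2 - 2 / ?n)"
  then have sum_eq: "(\<Sum>y\<in>W. F ((norm (x - y))\<^sup>2)) = (\<Sum>y\<in>W. h ((norm (x - y))\<^sup>2))"
    using sum_h by (simp add: s_def)
  have vals: "(norm (x - y))\<^sup>2 = s \<or> (norm (x - y))\<^sup>2 = 4" if y: "y \<in> W" for y
  proof -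
    have "F ((norm (x - y))\<^sup>2) = h ((norm (x - y))\<^sup>2)"
      using sum_mono_inv[OF sum_eq _ y fin] le_h by blast
    then show ?thesis
      using contact[OF strict x(2)[OF y]] by (simp add: h_def)
  qed
  \<comment> \<open>the squared distances from a point of the sphere have mean \<open>2\<close>, whereas \<open>s < 2\<close>\<close>
  have "\<exists>y\<in>W. (norm (x - y))\<^sup>2 \<noteq> s"
  proof (rule ccontr)
    assume "\<not> ?thesis"
    then have "(\<Sum>y\<in>W. (norm (x - y))\<^sup>2) = real (card W) * s"
      by simp
    then have "(?n + 1) * s = (?n + 1) * 2"
      using regular_simplex_sum_dist_power2[OF W x(1)] card by (simp add: add.commute)
    then have "s = 2"
      using n by (subst (asm) mult_cancel_left) auto
    then show False
      using n by (simp add: s_def)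
  qed
  then obtain y where "y \<in> W" "(norm (x - y))\<^sup>2 = 4"
    using vals by blast
  then show "x \<in> uminus ` W"
    using antipode_if_norm_diff_power2_eq_4[OF x(1) regular_simplex_unit[OF W]] by blast
qed

lemma strictly_convex_on_reflect:
  assumes "strictly_convex_on {a<..<b} g"
  shows "strictly_convex_on {a<..<b} (\<lambda>t. g (a + b - t))"
  unfolding strictly_convex_on_def
proof (intro conjI ballI allI impI)
  fix x y u v :: real
  assume x: "x \<in> {a<..<b}" and y: "y \<in> {a<..<b}" and uv: "u > 0" "v > 0" "u + v = 1" and "x \<noteq> y"
  have "u * (a + b) + v * (a + b) = a + b"
    using uv(3) by (metis distrib_right mult_1)
  then have "a + b - (u * x + v * y) = u * (a + b - x) + v * (a + b - y)"
    by (simp add: right_diff_distrib)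
  then show "g (a + b - (u * x + v * y)) < u * g (a + b - x) + v * g (a + b - y)"
    using assms x y uv \<open>x \<noteq> y\<close> unfolding strictly_convex_on_def by simp
qed simp

lemma convex_on_reflect:
  fixes g :: "real \<Rightarrow> real"
  assumes "convex_on {a<..<b} g"
  shows "convex_on {a<..<b} (\<lambda>t. g (a + b - t))"
  unfolding convex_on_def
proof (intro conjI ballI allI impI)
  fix x y u v :: real
  assume x: "x \<in> {a<..<b}" and y: "y \<in> {a<..<b}" and uv: "u \<ge> 0" "v \<ge> 0" "u + v = 1"
  have "u * (a + b) + v * (a + b) = a + b"
    using uv(3) by (metis distrib_right mult_1)
  then have "a + b - (u *\<^sub>R x + v *\<^sub>R y) = u *\<^sub>R (a + b - x) + v *\<^sub>R (a + b - y)"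
    by (simp add: right_diff_distrib)
  then show "g (a + b - (u *\<^sub>R x + v *\<^sub>R y)) \<le> u * g (a + b - x) + v * g (a + b - y)"
    using assms x y uv unfolding convex_on_def by simp
qed simp

text \<open>
  Apply the upper bound to \<open>t \<mapsto> -F (4 - t)\<close> and the point \<open>-x\<close>; the antipodes of \<open>W\<close> become
  \<open>W\<close> itself.
\<close>

lemma simplex_potential_lower_bound:
  fixes F F' :: "real \<Rightarrow> real" and W :: "(real ^ 'd) set"
  assumes dim: "CARD('d) \<ge> 2"
    and W: "regular_simplex_vertices W"
    and cont: "continuous_on {0..4} F"
    and deriv: "\<And>t. 0 < t \<Longrightarrow> t < 4 \<Longrightarrow> (F has_real_derivative F' t) (at t)"
    and conv: "convex_on {0<..<4} F'"
    and x: "norm x = 1"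
  shows "F 0 + real CARD('d) * F (2 + 2 / real CARD('d)) \<le> (\<Sum>y\<in>W. F ((norm (x - y))\<^sup>2))"
    and "strictly_convex_on {0<..<4} F' \<Longrightarrow>
      (\<Sum>y\<in>W. F ((norm (x - y))\<^sup>2)) = F 0 + real CARD('d) * F (2 + 2 / real CARD('d)) \<Longrightarrow>
      x \<in> W"
proof -
  define G where "G t = - F (4 - t)" for t
  have "continuous_on {0..4} G"
    unfolding G_def by (intro continuous_intros continuous_on_compose2[OF cont]) auto
  moreover have "(G has_real_derivative F' (4 - t)) (at t)" if "0 < t" "t < 4" for t
  proof -
    have "((\<lambda>t. 4 - t) has_real_derivative - 1) (at t)"
      by (auto intro!: derivative_eq_intros)
    from DERIV_chain'[OF this deriv[of "4 - t"]] that show ?thesis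
      unfolding G_def using DERIV_minus by fastforce
  qed
  moreover have "convex_on {0<..<4} (\<lambda>t. F' (4 - t))"
    using convex_on_reflect[OF conv] by simp
  moreover have "{0<..4} \<subseteq> {0..4::real}"
    by auto
  moreover have "(norm (- x - y))\<^sup>2 \<in> {0..4}" if "y \<in> W" for y
    using norm_diff_power2_unit_range[of "- x" y] x regular_simplex_unit[OF W that] by simp
  ultimately have bound:
      "(\<Sum>y\<in>W. G ((norm (- x - y))\<^sup>2)) \<le> G 4 + real CARD('d) * G (2 - 2 / real CARD('d))"
    and unique: "strictly_convex_on {0<..<4} (\<lambda>t. F' (4 - t)) \<Longrightarrow>
      (\<Sum>y\<in>W. G ((norm (- x - y))\<^sup>2)) = G 4 + real CARD('d) * G (2 - 2 / real CARD('d)) \<Longrightarrow>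
      - x \<in> uminus ` W"
    using simplex_potential_upper_bound[OF dim W, of "{0..4}" G "\<lambda>t. F' (4 - t)" "- x"] x
    by auto
  have "(\<Sum>y\<in>W. G ((norm (- x - y))\<^sup>2)) = (\<Sum>y\<in>W. - F ((norm (x - y))\<^sup>2))"
    by (rule sum.cong)
      (auto simp: G_def norm_minus_diff_power2_unit x regular_simplex_unit[OF W])
  then have sum_G: "(\<Sum>y\<in>W. G ((norm (- x - y))\<^sup>2)) = - (\<Sum>y\<in>W. F ((norm (x - y))\<^sup>2))"
    by (simp add: sum_negf)
  have val_G: "G 4 + real CARD('d) * G (2 - 2 / real CARD('d)) =
      - (F 0 + real CARD('d) * F (2 + 2 / real CARD('d)))"
    by (simp add: G_def algebra_simps)
  show "F 0 + real CARD('d) * F (2 + 2 / real CARD('d)) \<le> (\<Sum>y\<in>W. F ((norm (x - y))\<^sup>2))"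
    using bound unfolding sum_G val_G by simp
  assume "strictly_convex_on {0<..<4} F'"
    and "(\<Sum>y\<in>W. F ((norm (x - y))\<^sup>2)) = F 0 + real CARD('d) * F (2 + 2 / real CARD('d))"
  then have "- x \<in> uminus ` W"
    using unique strictly_convex_on_reflect[of 0 4 F'] unfolding sum_G val_G by simp
  then show "x \<in> W"
    by auto
qed

text \<open>
  What remains is the passage to extended reals. If \<open>f 0\<close> is finite, all sums are real. If not,
  the potential is \<open>-\<infinity>\<close> at the vertices, which are then no candidates for the maximum, and real
  elsewhere.
\<close>

theorem corollary2p5:
  fixes f :: "real \<Rightarrow> ereal" and W :: "(real ^ 'd) set"
  assumes dim: "CARD('d) \<ge> 2"
    and not_PInf: "\<And>t. t \<in> {0..4} \<Longrightarrow> f t \<noteq> \<infinity>"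
    and f_finite: "\<And>t. t \<in> {0<..4} \<Longrightarrow> f t \<noteq> - \<infinity>"
    and cont: "continuous_on {0<..4} f"
    and diff: "(\<lambda>t. real_of_ereal (f t)) differentiable_on {0<..<4}"
    and conv: "convex_on {0<..<4} (deriv (\<lambda>t. real_of_ereal (f t)))"
    and lim0: "(f \<longlongrightarrow> f 0) (at_right 0)"
    and simplex: "regular_simplex_vertices W"
  shows
    "(\<forall>z\<in>uminus ` W. is_arg_max (potential f W) (\<lambda>x. x \<in> sphere 0 1) z) \<and>
     max_potential f W
       = f 4 + ereal (real CARD('d)) * f (2 - 2 / real CARD('d)) \<and>
     (f 0 > - \<infinity> \<longrightarrow>
       (\<forall>z\<in>W. is_arg_min (potential f W) (\<lambda>x. x \<in> sphere 0 1) z) \<and>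
       min_potential f W
         = f 0 + ereal (real CARD('d)) * f (2 + 2 / real CARD('d))) \<and>
     (strictly_convex_on {0<..<4} (deriv (\<lambda>t. real_of_ereal (f t))) \<longrightarrow>
       (\<forall>z. is_arg_max (potential f W) (\<lambda>x. x \<in> sphere 0 1) z \<longrightarrow> z \<in> uminus ` W) \<and>
       (f 0 > - \<infinity> \<longrightarrow>
         (\<forall>z. is_arg_min (potential f W) (\<lambda>x. x \<in> sphere 0 1) z \<longrightarrow> z \<in> W)))"
proof -
  let ?n = "real CARD('d)"
  define g where "g t = real_of_ereal (f t)" for t
  let ?max = "g 4 + ?n * g (2 - 2 / ?n)"
  let ?min = "g 0 + ?n * g (2 + 2 / ?n)"
  have g_eta: "g = (\<lambda>t. real_of_ereal (f t))"
    by (simp add: g_def fun_eq_iff)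
  have n: "?n \<ge> 2"
    using dim by simp
  then have nodes: "2 - 2 / ?n \<in> {0<..4}" "2 + 2 / ?n \<in> {0<..4}"
    by (auto simp: field_simps)
  have fin: "finite W" and card: "card W = CARD('d) + 1"
    using simplex regular_simplex_finite unfolding regular_simplex_vertices_def by auto
  then obtain w where w: "w \<in> W"
    by fastforce
  have unit: "norm y = 1" if "y \<in> W" for y
    by (rule regular_simplex_unit[OF simplex that])
  have f_eq: "f t = ereal (g t)" if "t \<in> {0<..4}" for t
    using not_PInf[of t] f_finite[OF that] that by (cases "f t") (auto simp: g_def)
  have conv_g: "convex_on {0<..<4} (deriv g)"
    using conv by (simp add: g_eta)
  have deriv_g: "(g has_real_derivative deriv g t) (at t)" if "0 < t" "t < 4" for t
  proof -
    have "g differentiable (at t within {0<..<4})"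
      using diff that by (simp add: g_eta differentiable_on_def)
    then have "g differentiable (at t)"
      using that by (simp add: at_within_open[of t "{0<..<4}"])
    then show ?thesis
      by (simp add: DERIV_deriv_iff_real_differentiable)
  qed
  have "continuous_on {0<..4} g"
    using cont f_finite not_PInf
    by (subst (asm) continuous_on_iff_real) (auto simp: g_eta comp_def abs_eq_infinity_cases)
  have dist_range: "(norm (x - y))\<^sup>2 \<in> {0..4}" if "norm x = 1" "y \<in> W" for x y
    by (rule norm_diff_power2_unit_range[OF that(1) unit[OF that(2)]])
  have potential_eq: "potential f W x = ereal (\<Sum>y\<in>W. g ((norm (x - y))\<^sup>2))"
    if "\<And>y. y \<in> W \<Longrightarrow> f ((norm (x - y))\<^sup>2) = ereal (g ((norm (x - y))\<^sup>2))" for x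
    unfolding potential_def using that by (simp flip: sum_ereal)

  have off_vertices: "(norm (x - y))\<^sup>2 \<in> {0<..4}" if "norm x = 1" "x \<notin> W" "y \<in> W" for x y
    using dist_range[OF that(1,3)] that by (auto simp: less_le)
  have potential_off: "potential f W x = ereal (\<Sum>y\<in>W. g ((norm (x - y))\<^sup>2))"
    if "norm x = 1" "x \<notin> W" for x
    by (intro potential_eq f_eq off_vertices that)
  have vertex_distances: "f ((norm (w - y))\<^sup>2) = ereal (g ((norm (w - y))\<^sup>2))"
    if "w \<in> W" "y \<in> W" "y \<noteq> w" for w y
    using dist_range[OF unit[OF that(1)] that(2)] that by (intro f_eq) (auto simp: less_le)

  have at_vertex: "potential f W w = - \<infinity>" if "f 0 = - \<infinity>" "w \<in> W" for w
  proof -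
    have "potential f W w = f 0 + (\<Sum>y\<in>W - {w}. f ((norm (w - y))\<^sup>2))"
      unfolding potential_def
      using sum.remove[OF fin that(2), of "\<lambda>y. f ((norm (w - y))\<^sup>2)"] by simp
    also have "(\<Sum>y\<in>W - {w}. f ((norm (w - y))\<^sup>2)) = ereal (\<Sum>y\<in>W - {w}. g ((norm (w - y))\<^sup>2))"
      unfolding sum_ereal[symmetric] by (rule sum.cong) (auto simp: vertex_distances that)
    finally show ?thesis
      using that by simp
  qed

  have cont_closed: "continuous_on {0..4} g" and f_eq_closed: "\<And>t. t \<in> {0..4} \<Longrightarrow> f t = ereal (g t)"
    if f0: "f 0 > - \<infinity>"
  proof -
    have finite: "\<bar>f t\<bar> \<noteq> \<infinity>" if "t \<in> {0..4}" for t
      using not_PInf[OF that] f_finite[of t] f0 that by (cases "t = 0") auto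
    then show "f t = ereal (g t)" if "t \<in> {0..4}" for t
      using finite[OF that] by (simp add: g_def ereal_real')
    have "continuous_on {0..4} f"
      unfolding continuous_on_def
    proof
      fix t :: real assume t: "t \<in> {0..4}"
      show "(f \<longlongrightarrow> f t) (at t within {0..4})"
      proof (cases "t = 0")
        case True
        then show ?thesis
          using lim0 by (simp add: at_within_Icc_at_right)
      next
        case False
        then have "t \<in> {0<..4}"
          using t by auto
        then have "(f \<longlongrightarrow> f t) (at t within {0<..4})"
          using cont by (auto simp: continuous_on_def)
        moreover have "at t within {0<..4} = at t within {0..4}"
          \<comment> \<open>both sets agree near \<open>t > 0\<close>\<close>
          using \<open>t \<in> {0<..4}\<close> by (intro at_within_nhd[of t "{0<..}"]) auto
        ultimately show ?thesis by simp
      qed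
    qed
    then show "continuous_on {0..4} g"
      using finite by (subst (asm) continuous_on_iff_real) (auto simp: g_eta comp_def)
  qed
  have potential_closed: "potential f W x = ereal (\<Sum>y\<in>W. g ((norm (x - y))\<^sup>2))"
    if "f 0 > - \<infinity>" "norm x = 1" for x
    by (intro potential_eq f_eq_closed dist_range that)

  have I: "{0<..4} \<subseteq> {0<..4::real}" "{0<..4} \<subseteq> {0..4::real}" "{0..4} \<subseteq> {0..4::real}"
    by auto
  have upper: "potential f W x \<le> ereal ?max \<and>
      (strictly_convex_on {0<..<4} (deriv g) \<longrightarrow> potential f W x = ereal ?max \<longrightarrow> x \<in> uminus ` W)"
    if x: "norm x = 1" for x
  proof (cases "f 0 = - \<infinity>")
    case True
    show ?thesis
    proof (cases "x \<in> W")
      case True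
      then show ?thesis
        using at_vertex[OF \<open>f 0 = - \<infinity>\<close>] by simp
    next
      case False
      note bound = simplex_potential_upper_bound[OF dim simplex I(1,2) \<open>continuous_on {0<..4} g\<close>
          deriv_g conv_g x off_vertices[OF x False]]
      show ?thesis
        unfolding potential_off[OF x False] using bound by auto
    qed
  next
    case False
    then have f0: "f 0 > - \<infinity>"
      by simp
    note bound = simplex_potential_upper_bound[OF dim simplex I(2,3) cont_closed[OF f0]
        deriv_g conv_g x dist_range[OF x]]
    show ?thesis
      unfolding potential_closed[OF f0 x] using bound by auto
  qed
  have antipode_value: "potential f W (- v) = ereal ?max" if v: "v \<in> W" for v
  proof -
    \<comment> \<open>inner products of vertices are \<open>1\<close> or \<open>- 1 / n\<close>; only in dimension one could they be \<open>- 1\<close>\<close>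
    have "- v \<notin> W"
    proof
      assume "- v \<in> W"
      then have "- v \<bullet> v = 1 \<or> - v \<bullet> v = - 1 / ?n"
        using regular_simplex_sum_and_inner(2)[OF simplex _ v, of "- v"] by argo
      moreover have "- v \<bullet> v = - 1"
        using unit[OF v] by (simp add: norm_eq_1)
      ultimately show False
        using n by auto
    qed
    then show ?thesis
      using potential_off[of "- v"] unit[OF v] sum_dist_power2_at_antipode[OF simplex v, of g]
      by simp
  qed
  have lower: "ereal ?min \<le> potential f W x \<and>
      (strictly_convex_on {0<..<4} (deriv g) \<longrightarrow> potential f W x = ereal ?min \<longrightarrow> x \<in> W)"
    if f0: "f 0 > - \<infinity>" and x: "norm x = 1" for x
    unfolding potential_closed[OF f0 x]
    using simplex_potential_lower_bound[OF dim simplex cont_closed[OF f0] deriv_g conv_g x]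
    by auto
  have vertex_value: "potential f W v = ereal ?min" if "f 0 > - \<infinity>" "v \<in> W" for v
    using potential_closed[OF that(1) unit[OF that(2)]]
      sum_dist_power2_at_vertex[OF simplex that(2), of g] by simp

  have max_iff: "is_arg_max (potential f W) (\<lambda>x. x \<in> sphere 0 1) z \<longleftrightarrow>
      norm z = 1 \<and> potential f W z = ereal ?max" for z
    unfolding is_arg_max_linorder mem_sphere_0
    using upper antipode_value[OF w] unit[OF w] by (metis antisym norm_minus_cancel)
  have min_iff: "is_arg_min (potential f W) (\<lambda>x. x \<in> sphere 0 1) z \<longleftrightarrow>
      norm z = 1 \<and> potential f W z = ereal ?min" if "f 0 > - \<infinity>" for z
    unfolding is_arg_min_linorder mem_sphere_0
    using lower[OF that] vertex_value[OF that w] unit[OF w] by (metis antisym)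
  have "max_potential f W = ereal ?max"
    unfolding max_potential_def
    using upper antipode_value[OF w] unit[OF w]
    by (intro antisym SUP_least SUP_upper2[of "- w"]) auto
  then have max_value: "max_potential f W = f 4 + ereal ?n * f (2 - 2 / ?n)"
    using f_eq[OF nodes(1)] f_eq[of 4] by simp
  have min_value: "min_potential f W = f 0 + ereal ?n * f (2 + 2 / ?n)" if "f 0 > - \<infinity>"
  proof -
    have "min_potential f W = ereal ?min"
      unfolding min_potential_def
      using lower[OF that] vertex_value[OF that w] unit[OF w]
      by (intro antisym INF_greatest INF_lower2[of w]) auto
    then show ?thesis
      using f_eq[OF nodes(2)] f_eq_closed[OF that, of 0] by simp
  qed
  show ?thesis
    unfolding g_eta[symmetric]
    using max_iff min_iff max_value min_value antipode_value vertex_value upper lower unit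
    by auto
qed

end
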